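(* Let $1\le p<\infty$ and let $\mu_1$ and $\mu_2$ be locally $p$-admissible measures on $\mathbf{R}$. Then $\mu=\mu_1+\mu_2$ is locally $p$-admissible on $\mathbf{R}$.
   Context: A measure on $\mathbf{R}$ means a positive complete Borel measure $\mu$ with $0<\mu(B)<\infty$ for every ball $B$. Balls $B=B(x,r)$ in $\mathbf{R}$ are the bounded open intervals $(x-r,x+r)$, with radius $r_B=r$, and $\lambda B=B(x,\lambda r)$. Write $u_B=\frac{1}{\mu(B)}\int_B u\,d\mu$. Upper gradient: a Borel function $g\ge 0$ on a metric space $Y$ is an upper gradient of $u:Y\to[-\infty,\infty]$ if $|u(\gamma(0))-u(\gamma(l_\gamma))|\le\int_\gamma g\,ds$ for every nonconstant compact rectifiable curve $\gamma:[0,l_\gamma]\to Y$ parameterized by arc length (the left-hand side is interpreted as $\infty$ if at least one of the two terms is $\pm\infty$). Let $B_0$ be a ball in $\mathbf{R}$. - $\mu$ is doubling within $B_0$ if there is $C>0$ such that $\mu(2B)\le C\mu(B)$ for all balls $B\subset B_0$. - The $p$-Poincaré inequality holds within $B_0$ if there are $C>0$ and $\lambda\ge1$ such that for all balls $B\subset B_0$, all integrable functions $u$ on $\lambda B$ and all upper gradients $g$ of $u$ on $\lambda B$, $$\frac{1}{\mu(B)}\int_B|u-u_B|\,d\mu\le C r_B\Bigl(\frac{1}{\mu(\lambda B)}\int_{\lambda B}g^p\,d\mu\Bigr)^{1/p}.$$ - $\mu$ is $p$-admissible within $B_0$ if it is doubling and supports a $p$-Poincaré inequality within $B_0$. $\mu$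 is locally $p$-admissible if for every $x\in\mathbf{R}$ there is $R_x>0$ such that $\mu$ is $p$-admissible within $B(x,R_x)$, with constants that may depend on $x$. *)

theory Defs
  imports "HOL-Analysis.Analysis"
begin

section \<open>Measures on the real line\<close>

text \<open>A complete Borel measure is a complete measure defined (at least) on all Borel sets;
  its \<open>\<sigma>\<close>-algebra may be larger than the Borel \<open>\<sigma>\<close>-algebra.\<close>

definition measure_on_R :: "real measure \<Rightarrow> bool" where
  "measure_on_R M \<longleftrightarrow>
     space M = UNIV \<and> sets borel \<subseteq> sets M \<and> complete_measure M \<and>
     (\<forall>x r. 0 < r \<longrightarrow> 0 < emeasure M (ball x r) \<and> emeasure M (ball x r) < \<infinity>)"

text \<open>The sum of two measures lives on the sets measurable for both of them. If both are
  completions of Borel measures, this is the completion of the sum of the Borel measures.\<close>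

definition sum_measure :: "'a measure \<Rightarrow> 'a measure \<Rightarrow> 'a measure" where
  "sum_measure M N =
     measure_of (space M) (sets M \<inter> sets N) (\<lambda>A. emeasure M A + emeasure N A)"

lemma
  assumes "space M = space N"
  shows space_sum_measure: "space (sum_measure M N) = space M"
    and sets_sum_measure: "sets (sum_measure M N) = sets M \<inter> sets N"
    and emeasure_sum_measure: "A \<in> sets M \<Longrightarrow> A \<in> sets N \<Longrightarrow>
      emeasure (sum_measure M N) A = emeasure M A + emeasure N A"
proof -
  have sub: "sets M \<inter> sets N \<subseteq> Pow (space M)"
    using sets.sets_into_space by auto
  interpret sigma_algebra "space M" "sets M \<inter> sets N"
    using sub assms sets.top[of N] sets.compl_sets[of _ M] sets.compl_sets[of _ N]
    by (auto simp: sigma_algebra_iff2)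
  show "space (sum_measure M N) = space M"
    unfolding sum_measure_def using sub by (simp add: space_measure_of)
  show "sets (sum_measure M N) = sets M \<inter> sets N"
    unfolding sum_measure_def using sets_measure_of_eq by simp
  have "countably_additive (sets M \<inter> sets N) (\<lambda>A. emeasure M A + emeasure N A)"
  proof (rule countably_additiveI)
    fix A :: "nat \<Rightarrow> _"
    assume A: "range A \<subseteq> sets M \<inter> sets N" "disjoint_family A"
    have "(\<Sum>i. emeasure M (A i)) = emeasure M (\<Union>i. A i)"
      "(\<Sum>i. emeasure N (A i)) = emeasure N (\<Union>i. A i)"
      using A by (auto intro!: suminf_emeasure)
    then show "(\<Sum>i. emeasure M (A i) + emeasure N (A i)) =
        emeasure M (\<Union>i. A i) + emeasure N (\<Union>i. A i)"
      by (simp add: suminf_add[symmetric])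
  qed
  moreover have "positive (sets M \<inter> sets N) (\<lambda>A. emeasure M A + emeasure N A)"
    by (simp add: positive_def)
  ultimately show "emeasure (sum_measure M N) A = emeasure M A + emeasure N A"
    if "A \<in> sets M" "A \<in> sets N"
    unfolding sum_measure_def
    using that emeasure_measure_of_sigma[OF sigma_algebra_axioms] by simp
qed

section \<open>Curves and upper gradients\<close>

text \<open>The length of the restriction of \<open>\<gamma>\<close> to \<open>[a, b]\<close>: the supremum of the
  lengths of inscribed polygons, with vertices at the nondecreasing parameters \<open>ts\<close>.\<close>

definition curve_length :: "(real \<Rightarrow> 'a::metric_space) \<Rightarrow> real \<Rightarrow> real \<Rightarrow> ennreal" where
  "curve_length \<gamma> a b =
     (SUP ts \<in> {ts. sorted ts \<and> set ts \<subseteq> {a..b}}.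
        \<Sum>i<length ts - 1. ennreal (dist (\<gamma> (ts ! i)) (\<gamma> (ts ! Suc i))))"

text \<open>Nonconstant compact rectifiable curves \<open>\<gamma> : [0, l] \<rightarrow> Y\<close> parameterized by arc
  length; such a curve has length \<open>l\<close>, so it is nonconstant exactly if \<open>0 < l\<close>.\<close>

definition arc_length_curve ::
    "'a::metric_space set \<Rightarrow> real \<Rightarrow> (real \<Rightarrow> 'a) \<Rightarrow> bool" where
  "arc_length_curve Y l \<gamma> \<longleftrightarrow>
     0 < l \<and> continuous_on {0..l} \<gamma> \<and> \<gamma> ` {0..l} \<subseteq> Y \<and>
     (\<forall>t\<in>{0..l}. curve_length \<gamma> 0 t = ennreal t)"

text \<open>\<open>|a - b|\<close>, interpreted as \<open>\<infinity>\<close> if \<open>a\<close> or \<open>b\<close> is infinite. The explicit case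
  distinction is needed because \<open>\<infinity> - \<infinity>\<close> has a fixed value in \<^typ>\<open>ereal\<close>.\<close>

definition ext_diff :: "ereal \<Rightarrow> ereal \<Rightarrow> ennreal" where
  "ext_diff a b = (if \<bar>a\<bar> = \<infinity> \<or> \<bar>b\<bar> = \<infinity> then \<infinity> else e2ennreal \<bar>a - b\<bar>)"

definition upper_gradient ::
    "'a::metric_space set \<Rightarrow> ('a \<Rightarrow> ereal) \<Rightarrow> ('a \<Rightarrow> ennreal) \<Rightarrow> bool" where
  "upper_gradient Y u g \<longleftrightarrow>
     g \<in> borel_measurable (restrict_space borel Y) \<and>
     (\<forall>l \<gamma>. arc_length_curve Y l \<gamma> \<longrightarrow>
        ext_diff (u (\<gamma> 0)) (u (\<gamma> l)) \<le> (\<integral>\<^sup>+t\<in>{0..l}. g (\<gamma> t) \<partial>lborel))"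

section \<open>Admissible measures\<close>

text \<open>Powers with exponent \<open>a > 0\<close> on \<open>[0, \<infinity>]\<close>.\<close>

definition ennpowr :: "ennreal \<Rightarrow> real \<Rightarrow> ennreal" where
  "ennpowr x a = (if x = \<infinity> then \<infinity> else ennreal (enn2real x powr a))"

definition integrable_on_set :: "'a measure \<Rightarrow> 'a set \<Rightarrow> ('a \<Rightarrow> ereal) \<Rightarrow> bool" where
  "integrable_on_set M A u \<longleftrightarrow>
     u \<in> borel_measurable (restrict_space M A) \<and>
     (\<integral>\<^sup>+x\<in>A. e2ennreal \<bar>u x\<bar> \<partial>M) < \<infinity>"

text \<open>An integrable extended real-valued function is finite almost everywhere, so passing to
  \<^const>\<open>real_of_ereal\<close> does not change its integral.\<close>

definition mean :: "'a measure \<Rightarrow> 'a set \<Rightarrow> ('a \<Rightarrow> ereal) \<Rightarrow> real" where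
  "mean M A u = (LINT x:A|M. real_of_ereal (u x)) / measure M A"

definition doubling_within :: "real measure \<Rightarrow> real set \<Rightarrow> bool" where
  "doubling_within M B0 \<longleftrightarrow>
     (\<exists>C::real. 0 < C \<and>
        (\<forall>x r. 0 < r \<longrightarrow> ball x r \<subseteq> B0 \<longrightarrow>
           emeasure M (ball x (2 * r)) \<le> ennreal C * emeasure M (ball x r)))"

definition Poincare_within :: "real \<Rightarrow> real measure \<Rightarrow> real set \<Rightarrow> bool" where
  "Poincare_within p M B0 \<longleftrightarrow>
     (\<exists>C \<Lambda> :: real. 0 < C \<and> 1 \<le> \<Lambda> \<and>
        (\<forall>x r. 0 < r \<longrightarrow> ball x r \<subseteq> B0 \<longrightarrow>
           (\<forall>u g. integrable_on_set M (ball x (\<Lambda> * r)) u \<longrightarrow>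
                  upper_gradient (ball x (\<Lambda> * r)) u g \<longrightarrow>
              (\<integral>\<^sup>+y\<in>ball x r. e2ennreal \<bar>u y - ereal (mean M (ball x r) u)\<bar> \<partial>M)
                  / emeasure M (ball x r)
              \<le> ennreal (C * r) *
                ennpowr ((\<integral>\<^sup>+y\<in>ball x (\<Lambda> * r). ennpowr (g y) p \<partial>M)
                           / emeasure M (ball x (\<Lambda> * r))) (1 / p))))"

definition admissible_within :: "real \<Rightarrow> real measure \<Rightarrow> real set \<Rightarrow> bool" where
  "admissible_within p M B0 \<longleftrightarrow> doubling_within M B0 \<and> Poincare_within p M B0"

definition locally_admissible :: "real \<Rightarrow> real measure \<Rightarrow> bool" where
  "locally_admissible p M \<longleftrightarrow> (\<forall>x. \<exists>R>0. admissible_within p M (ball x R))"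

end

theory Submission
  imports Defs
begin

text \<open>The Poincare inequality for \<open>\<mu>\<^sub>i\<close> on a threefold ball \<open>3B\<close>, applied to a primitive of a function
  \<open>h \<ge> 0\<close> supported in \<open>B\<close>, yields together with doubling
  \<open>\<mu>\<^sub>i(B) (\<integral>\<^sub>B h dx)\<^sup>p \<le> C r\<^sub>B\<^sup>p \<integral>\<^sub>B h\<^sup>p d\<mu>\<^sub>i\<close>.
  Adding these inequalities for \<open>i = 1, 2\<close> gives the same inequality for \<open>\<mu> = \<mu>\<^sub>1 + \<mu>\<^sub>2\<close>. It implies the
  Poincare inequality for \<open>\<mu>\<close> with dilation 1, since on the line \<open>u\<close> oscillates on \<open>B\<close> by at most
  \<open>\<integral>\<^sub>B g dx\<close> whenever \<open>g\<close> is an upper gradient of \<open>u\<close> on \<open>B\<close>.\<close>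

section \<open>Powers and quotients of extended nonnegative reals\<close>

lemma ennpowr_mono: "0 < a \<Longrightarrow> x \<le> y \<Longrightarrow> ennpowr x a \<le> ennpowr y a"
  by (cases x; cases y) (auto simp: ennpowr_def top_unique intro!: powr_mono2)

lemma ennpowr_ennpowr_inverse: "a \<noteq> 0 \<Longrightarrow> ennpowr (ennpowr x (1 / a)) a = x"
  by (cases x) (auto simp: ennpowr_def powr_powr)

lemma ennpowr_ennpowr_inverse': "a \<noteq> 0 \<Longrightarrow> ennpowr (ennpowr x a) (1 / a) = x"
  by (cases x) (auto simp: ennpowr_def powr_powr)

lemma ennpowr_mult: "0 < a \<Longrightarrow> ennpowr (x * y) a = ennpowr x a * ennpowr y a"
proof -
  assume a: "0 < a"
  show ?thesis
  proof (cases "x = \<infinity> \<or> y = \<infinity>")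
    case True
    then show ?thesis
      by (cases x; cases y)
        (auto simp: ennpowr_def ennreal_mult_top ennreal_top_mult top_unique)
  next
    case False
    then show ?thesis
      by (auto simp: ennpowr_def enn2real_mult powr_mult ennreal_mult ennreal_mult_eq_top_iff)
  qed
qed

lemma ennpowr_measurable [measurable]: "(\<lambda>x. ennpowr x a) \<in> borel_measurable borel"
  unfolding ennpowr_def by measurable

lemma divide_left_mono_ennreal: "0 < b \<Longrightarrow> b \<le> c \<Longrightarrow> a / c \<le> a / (b::ennreal)"
  unfolding divide_ennreal_def
  by (cases b; cases c) (auto intro!: mult_left_mono simp: inverse_ennreal top_unique ennreal_leI)

lemma ennreal_mult_le_imp_le:
  "0 < c \<Longrightarrow> c < \<infinity> \<Longrightarrow> c * a \<le> c * b \<Longrightarrow> a \<le> (b::ennreal)"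
  by (subst (asm) ennreal_mult_le_mult_iff) auto

lemma ennreal_mult_divide_cancel:
  assumes "0 < m" "m < \<infinity>"
  shows "m * (a * (b / m)) = a * (b::ennreal)"
proof -
  have "m * (a * (b / m)) = a * (b * (m / m))"
    by (metis ennreal_divide_times mult.commute mult.left_commute)
  then show ?thesis using assms by simp
qed

text \<open>Raising to the power \<open>p\<close> is an increasing bijection of [0, \<infinity>],
  and multiplication by the finite positive \<open>m\<close> reflects the order. The right-hand form
  is linear in \<open>I\<close> and \<open>m\<close>, so such inequalities for two measures can be
  added.\<close>

lemma le_ennpowr_mean_iff:
  assumes "0 < p" "0 < m" "m < \<infinity>"
  shows "J \<le> k * ennpowr (I / m) (1 / p) \<longleftrightarrow> ennpowr J p * m \<le> ennpowr k p * I"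
proof -
  have "J \<le> k * ennpowr (I / m) (1 / p) \<longleftrightarrow> ennpowr J p \<le> ennpowr k p * (I / m)"
  proof
    assume "J \<le> k * ennpowr (I / m) (1 / p)"
    then have "ennpowr J p \<le> ennpowr (k * ennpowr (I / m) (1 / p)) p"
      using assms(1) by (intro ennpowr_mono)
    then show "ennpowr J p \<le> ennpowr k p * (I / m)"
      using assms(1) by (simp add: ennpowr_mult ennpowr_ennpowr_inverse)
  next
    assume "ennpowr J p \<le> ennpowr k p * (I / m)"
    then have "ennpowr (ennpowr J p) (1 / p) \<le> ennpowr (ennpowr k p * (I / m)) (1 / p)"
      using assms(1) by (intro ennpowr_mono) auto
    then show "J \<le> k * ennpowr (I / m) (1 / p)"
      using assms(1) by (simp add: ennpowr_mult ennpowr_ennpowr_inverse')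
  qed
  also have "\<dots> \<longleftrightarrow> m * ennpowr J p \<le> m * (ennpowr k p * (I / m))"
    using assms(2,3) by (intro ennreal_mult_le_mult_iff[symmetric]) auto
  also have "m * (ennpowr k p * (I / m)) = ennpowr k p * I"
    using assms(2,3) by (rule ennreal_mult_divide_cancel)
  also have "m * ennpowr J p = ennpowr J p * m"
    by (rule mult.commute)
  finally show ?thesis .
qed

text \<open>In the linear form of the previous equivalence both hypotheses have the same
  coefficients \<open>ennpowr J p\<close> and \<open>ennpowr k p\<close>, so their sum is again of
  this form.\<close>

lemma le_ennpowr_mean_add:
  assumes "0 < p" "0 < m" "m < \<infinity>" "0 < n" "n < \<infinity>"
    and "J \<le> k * ennpowr (I / m) (1 / p)" "J \<le> k * ennpowr (L / n) (1 / p)"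
  shows "J \<le> k * ennpowr ((I + L) / (m + n)) (1 / p)"
  using assms by (simp add: le_ennpowr_mean_iff distrib_left add_mono add_pos_pos)

section \<open>Sums of measures\<close>

text \<open>The \<sigma>-algebra of the sum is the intersection of the two, so measurability passes
  to both summands, and the identity passes from indicators to \<open>f\<close> by monotone
  approximation.\<close>

lemma nn_integral_sum_measure:
  assumes "space M = space N" and f: "f \<in> borel_measurable (sum_measure M N)"
  shows "integral\<^sup>N (sum_measure M N) f = integral\<^sup>N M f + integral\<^sup>N N f"
proof -
  note sm = sets_sum_measure[OF assms(1)] space_sum_measure[OF assms(1)]
  have meas: "f \<in> borel_measurable M \<and> f \<in> borel_measurable N"
    if "f \<in> borel_measurable (sum_measure M N)" for f :: "'a \<Rightarrow> ennreal"
    using that sm assms(1) by (auto simp: measurable_def)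
  show ?thesis
    using f
  proof (induction rule: borel_measurable_induct)
    case (cong f g)
    then show ?case
      using sm assms(1) by (metis (no_types, lifting) nn_integral_cong)
  next
    case (set A)
    then show ?case
      using sm emeasure_sum_measure[OF assms(1)] by simp
  next
    case (mult u c)
    then show ?case
      using meas by (simp add: nn_integral_cmult distrib_left)
  next
    case (add u v)
    then show ?case
      using meas by (simp add: nn_integral_add ac_simps)
  next
    case (seq U)
    \<comment> \<open>Both sequences of integrals increase, which permits splitting the supremum of
      their sums.\<close>
    have "incseq (\<lambda>i. integral\<^sup>N L (U i))" for L
      using seq(3) by (auto simp: incseq_def le_fun_def intro!: nn_integral_mono)
    then show ?case
      using seq meas
      by (simp add: nn_integral_monotone_convergence_SUP ennreal_SUP_add image_comp)
  qed
qed

lemma measure_on_R_sum_measure: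
  assumes "measure_on_R M" "measure_on_R N"
  shows "measure_on_R (sum_measure M N)"
proof -
  have sp: "space M = space N" using assms by (simp add: measure_on_R_def)
  note sm = sets_sum_measure[OF sp] space_sum_measure[OF sp] emeasure_sum_measure[OF sp]
  interpret M: complete_measure M using assms by (simp add: measure_on_R_def)
  interpret N: complete_measure N using assms by (simp add: measure_on_R_def)
  \<comment> \<open>A null set of the sum is null for both summands; completeness of each puts its
    subsets into the intersection of the two \<sigma>-algebras.\<close>
  have "complete_measure (sum_measure M N)"
  proof
    fix A B assume "B \<subseteq> A" "A \<in> null_sets (sum_measure M N)"
    then show "B \<in> sets (sum_measure M N)"
      using M.complete[of B A] N.complete[of B A] by (auto simp: null_sets_def sm)
  qed
  moreover have "ball x r \<in> sets M" "ball x r \<in> sets N" for x r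
    using assms by (auto simp: measure_on_R_def)
  ultimately show ?thesis
    using assms by (auto simp: measure_on_R_def sm add_pos_pos)
qed

lemma doubling_within_sum_measure:
  assumes "measure_on_R M" "measure_on_R N" "doubling_within M S" "doubling_within N S"
  shows "doubling_within (sum_measure M N) S"
proof -
  have sp: "space M = space N" using assms by (simp add: measure_on_R_def)
  have sets: "ball x r \<in> sets M" "ball x r \<in> sets N" for x r
    using assms by (auto simp: measure_on_R_def)
  obtain C D where C: "0 < C" "\<And>x r. 0 < r \<Longrightarrow> ball x r \<subseteq> S \<Longrightarrow>
      emeasure M (ball x (2 * r)) \<le> ennreal C * emeasure M (ball x r)"
    and D: "\<And>x r. 0 < r \<Longrightarrow> ball x r \<subseteq> S \<Longrightarrow>
      emeasure N (ball x (2 * r)) \<le> ennreal D * emeasure N (ball x r)"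
    using assms(3,4) unfolding doubling_within_def by metis
  show ?thesis
    unfolding doubling_within_def
  proof (intro exI[of _ "max C D"] conjI allI impI)
    fix x r :: real assume r: "0 < r" "ball x r \<subseteq> S"
    have "emeasure (sum_measure M N) (ball x (2 * r))
        \<le> ennreal C * emeasure M (ball x r) + ennreal D * emeasure N (ball x r)"
      using C(2)[OF r] D[OF r] by (simp add: emeasure_sum_measure[OF sp] sets add_mono)
    also have "\<dots> \<le> ennreal (max C D) * emeasure M (ball x r) + ennreal (max C D) * emeasure N (ball x r)"
      by (intro add_mono mult_right_mono ennreal_leI) auto
    also have "\<dots> = ennreal (max C D) * emeasure (sum_measure M N) (ball x r)"
      by (simp add: emeasure_sum_measure[OF sp] sets distrib_left)
    finally show "emeasure (sum_measure M N) (ball x (2 * r))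
        \<le> ennreal (max C D) * emeasure (sum_measure M N) (ball x r)" .
  qed (use C in auto)
qed

section \<open>Curves on the line and primitives\<close>

text \<open>Cover \<open>A\<close> by countably many nonoverlapping closed intervals whose total
  length exceeds that of \<open>A\<close> by at most \<open>e\<close>. A 1-Lipschitz map sends each
  into the closed ball about the image of its midpoint with half its length as radius, so covering
  the image costs no more length. The bound is stated for Borel subsets \<open>E\<close> of the
  image because the image itself need not be Borel.\<close>

lemma emeasure_le_of_lipschitz_image:
  fixes \<gamma> :: "real \<Rightarrow> real"
  assumes lip: "1-lipschitz_on {a..b} \<gamma>"
    and A: "A \<in> sets borel" "A \<subseteq> {a..b}" and E: "E \<in> sets borel" "E \<subseteq> \<gamma> ` A"
  shows "emeasure lborel E \<le> emeasure lborel A"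
proof (rule ennreal_le_epsilon)
  fix e :: real assume e: "0 < e"
  have A_lm: "A \<in> lmeasurable"
    using A by (intro bounded_set_imp_lmeasurable) (auto intro: bounded_subset[OF bounded_closed_interval])
  obtain D where D: "countable D"
      "\<And>K. K \<in> D \<Longrightarrow> K \<subseteq> cbox a b \<and> K \<noteq> {} \<and> (\<exists>c d. K = cbox c d)"
      "pairwise (\<lambda>A B. interior A \<inter> interior B = {}) D"
      "A \<subseteq> \<Union>D" "\<Union>D \<in> lmeasurable" "measure lebesgue (\<Union>D) \<le> measure lebesgue A + e"
    using measurable_outer_intervals_bounded[OF A_lm _ e, of a b] A(2) by (metis cbox_interval)
  have K: "\<exists>S\<in>sets borel. \<gamma> ` K \<subseteq> S \<and> emeasure lborel S \<le> emeasure lborel (interior K)"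
    if "K \<in> D" for K
  proof -
    from D(2)[OF that] obtain c d where cd: "K = {c..d}" "c \<le> d" "a \<le> c" "d \<le> b" by auto
    have "dist (\<gamma> ((c + d) / 2)) (\<gamma> t) \<le> (d - c) / 2" if "t \<in> K" for t
    proof -
      have "dist (\<gamma> ((c + d) / 2)) (\<gamma> t) \<le> 1 * dist ((c + d) / 2) t"
        using that cd by (intro lipschitz_onD[OF lip]) auto
      also have "\<dots> \<le> (d - c) / 2"
        using that cd by (auto simp: dist_real_def abs_le_iff field_simps)
      finally show ?thesis .
    qed
    then have "\<gamma> ` K \<subseteq> cball (\<gamma> ((c + d) / 2)) ((d - c) / 2)"
      by auto
    moreover have "emeasure lborel (cball (\<gamma> ((c + d) / 2)) ((d - c) / 2)) = emeasure lborel (interior K)"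
      using cd by (simp add: cball_eq_atLeastAtMost interior_atLeastAtMost_real field_simps)
    ultimately show ?thesis by (metis order_refl borel_closed closed_cball)
  qed
  then obtain S where S: "\<And>K. K \<in> D \<Longrightarrow> S K \<in> sets borel" "\<And>K. K \<in> D \<Longrightarrow> \<gamma> ` K \<subseteq> S K"
      "\<And>K. K \<in> D \<Longrightarrow> emeasure lborel (S K) \<le> emeasure lborel (interior K)"
    by metis
  have "emeasure lborel E = (\<integral>\<^sup>+x. indicator E x \<partial>lborel)"
    using E by simp
  \<comment> \<open>Countable subadditivity: the sum over \<open>D\<close> is an integral over the
    counting measure, which is then exchanged with the Lebesgue integral.\<close>
  also have "\<dots> \<le> (\<integral>\<^sup>+x. (\<integral>\<^sup>+K. indicator (S K) x \<partial>count_space D) \<partial>lborel)"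
  proof (rule nn_integral_mono)
    fix x
    show "indicator E x \<le> (\<integral>\<^sup>+K. indicator (S K) x \<partial>count_space D)"
    proof (cases "x \<in> E")
      case True
      then obtain K where K: "K \<in> D" "x \<in> S K"
        using E(2) D(4) S(2) by blast
      have "(1::ennreal) = indicator (S K) x" using K by simp
      also have "\<dots> \<le> (\<integral>\<^sup>+K. indicator (S K) x \<partial>count_space D)"
        using K(1) by (intro nn_integral_ge_point) auto
      finally show ?thesis using True by simp
    qed simp
  qed
  also have "\<dots> = (\<integral>\<^sup>+K. (\<integral>\<^sup>+x. indicator (S K) x \<partial>lborel) \<partial>count_space D)"
    using S(1) by (intro nn_integral_count_space_nn_integral[OF D(1)]) auto
  also have "\<dots> \<le> (\<integral>\<^sup>+K. emeasure lborel (interior K) \<partial>count_space D)"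
    using S by (intro nn_integral_mono) auto
  \<comment> \<open>Only the interiors are disjoint; end points have no length, so passing to
    interiors loses nothing.\<close>
  also have "\<dots> = emeasure lborel (\<Union>K\<in>D. interior K)"
    using D(1,3) by (intro emeasure_UN_countable[symmetric])
      (auto simp: disjoint_family_on_def pairwise_def)
  also have "\<dots> = emeasure lebesgue (\<Union>K\<in>D. interior K)"
    by (simp add: open_UN)
  also have "\<dots> \<le> emeasure lebesgue (\<Union>D)"
    using interior_subset D(5) by (intro emeasure_mono) (auto simp: fmeasurable_def)
  also have "\<dots> = ennreal (measure lebesgue (\<Union>D))"
    using D(5) by (intro emeasure_eq_ennreal_measure fmeasurableD2)
  also have "\<dots> \<le> ennreal (measure lebesgue A + e)"
    using D(6) by (rule ennreal_leI)
  also have "\<dots> = ennreal (measure lebesgue A) + ennreal e"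
    using e by (intro ennreal_plus) auto
  also have "ennreal (measure lebesgue A) = emeasure lebesgue A"
    using A_lm by (intro emeasure_eq_ennreal_measure[symmetric] fmeasurableD2)
  also have "emeasure lebesgue A = emeasure lborel A"
    using A by simp
  finally show "emeasure lborel E \<le> emeasure lborel A + ennreal e" .
qed

text \<open>The image of Lebesgue measure on \<open>{0..l}\<close> under \<open>\<gamma>\<close>
  dominates Lebesgue measure on \<open>I\<close>: the curve meets every point between its end
  points, so \<open>I \<inter> E\<close> lies in the image of the preimage of \<open>E\<close>, and
  the previous lemma applies. Integrating \<open>h\<close> against both measures gives the
  bound.\<close>

lemma nn_integral_le_along_lipschitz_curve:
  fixes \<gamma> :: "real \<Rightarrow> real"
  assumes lip: "1-lipschitz_on {0..l} \<gamma>" and "0 \<le> l"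
    and h: "h \<in> borel_measurable borel"
    and I: "I \<in> sets borel" "I \<subseteq> closed_segment (\<gamma> 0) (\<gamma> l)"
  shows "(\<integral>\<^sup>+y\<in>I. h y \<partial>lborel) \<le> (\<integral>\<^sup>+t\<in>{0..l}. h (\<gamma> t) \<partial>lborel)"
proof -
  let ?R = "restrict_space lborel {0..l}"
  have cont: "continuous_on {0..l} \<gamma>"
    using lip by (rule lipschitz_on_continuous_on)
  then have meas: "\<gamma> \<in> measurable ?R borel"
    using borel_measurable_continuous_on_restrict[OF cont]
    by (simp cong: measurable_cong_sets add: sets_restrict_space_cong[OF sets_lborel])
  have sub: "closed_segment (\<gamma> 0) (\<gamma> l) \<subseteq> \<gamma> ` {0..l}"
    using connected_continuous_image[OF cont] \<open>0 \<le> l\<close>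
    by (intro closed_segment_subset) (simp_all flip: is_interval_convex_1 add: is_interval_connected_1)
  have "(\<integral>\<^sup>+y\<in>I. h y \<partial>lborel) = integral\<^sup>N (density lborel (indicator I)) h"
    using h I by (subst nn_integral_density) (auto simp: mult.commute)
  also have "\<dots> \<le> integral\<^sup>N (distr ?R borel \<gamma>) h"
  proof (rule nn_integral_mono_measure)
    show "density lborel (indicator I) \<le> distr ?R borel \<gamma>"
    proof (subst le_measure)
      show "\<forall>E\<in>sets (density lborel (indicator I)).
        emeasure (density lborel (indicator I)) E \<le> emeasure (distr ?R borel \<gamma>) E"
      proof
        fix E assume "E \<in> sets (density lborel (indicator I))"
        then have E: "E \<in> sets borel" by simp
        let ?A = "\<gamma> -` E \<inter> space ?R"
        have A: "?A \<in> sets ?R" using meas E by (rule measurable_sets)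
        have A': "?A \<in> sets borel" "?A \<subseteq> {0..l}"
          using A by (auto simp: sets_restrict_space space_restrict_space)
        have "emeasure (density lborel (indicator I)) E = emeasure lborel (I \<inter> E)"
          using I E by (simp add: emeasure_density flip: indicator_inter_arith)
        also have "\<dots> \<le> emeasure lborel ?A"
        proof (rule emeasure_le_of_lipschitz_image[OF lip A'])
          show "I \<inter> E \<subseteq> \<gamma> ` ?A"
            using I(2) sub by (auto simp: space_restrict_space)
        qed (use I E in auto)
        also have "\<dots> = emeasure (distr ?R borel \<gamma>) E"
          using E meas A'(2) by (simp add: emeasure_distr emeasure_restrict_space space_restrict_space)
        finally show "emeasure (density lborel (indicator I)) E \<le> emeasure (distr ?R borel \<gamma>) E" .
      qed
    qed simp
  qed simp
  also have "\<dots> = (\<integral>\<^sup>+t. h (\<gamma> t) \<partial>?R)"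
    using meas h by (intro nn_integral_distr) auto
  also have "\<dots> = (\<integral>\<^sup>+t\<in>{0..l}. h (\<gamma> t) \<partial>lborel)"
    by (simp add: nn_integral_restrict_space)
  finally show ?thesis .
qed

section \<open>Curves parameterized by arc length\<close>

text \<open>A polygon inscribed up to \<open>s\<close> extends by the edge from \<open>s\<close> to
  \<open>t\<close> to one inscribed up to \<open>t\<close>. Since the curve has length
  \<open>s\<close> up to \<open>s\<close> and length \<open>t\<close> up to \<open>t\<close>, this
  edge is at most \<open>t - s\<close>.\<close>

lemma arc_length_curve_lipschitz:
  fixes \<gamma> :: "real \<Rightarrow> 'a::metric_space"
  assumes "arc_length_curve Y l \<gamma>"
  shows "1-lipschitz_on {0..l} \<gamma>"
proof -
  have len: "curve_length \<gamma> 0 t = ennreal t" if "t \<in> {0..l}" for t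
    using assms that by (simp add: arc_length_curve_def)
  have step: "dist (\<gamma> s) (\<gamma> t) \<le> t - s" if st: "0 \<le> s" "s \<le> t" "t \<le> l" for s t
  proof -
    let ?L = "\<lambda>ts. \<Sum>i<length ts - 1. ennreal (dist (\<gamma> (ts ! i)) (\<gamma> (ts ! Suc i)))"
    let ?S = "\<lambda>a. {ts. sorted ts \<and> set ts \<subseteq> {0..a}}"
    have "ennreal s + ennreal (dist (\<gamma> s) (\<gamma> t)) = (SUP ts\<in>?S s. ?L ts) + ennreal (dist (\<gamma> s) (\<gamma> t))"
      using len[of s] st by (simp add: curve_length_def)
    also have "\<dots> = (SUP ts\<in>?S s. ?L ts + ennreal (dist (\<gamma> s) (\<gamma> t)))"
      by (rule ennreal_SUP_add_left[symmetric]) (auto intro!: exI[of _ "[]"])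
    also have "\<dots> \<le> (SUP ts\<in>?S t. ?L ts)"
    proof (rule SUP_mono)
      fix ts assume ts: "ts \<in> ?S s"
      \<comment> \<open>Inserting \<open>s\<close> creates the edge from \<open>s\<close> to
        \<open>t\<close>; the edge from the last vertex of \<open>ts\<close> to \<open>s\<close>
        only adds length, and it is absent if \<open>ts\<close> is empty.\<close>
      let ?us = "ts @ [s, t]"
      have "?us \<in> ?S t" using ts st by (auto simp: sorted_append)
      moreover have "?L ts + ennreal (dist (\<gamma> s) (\<gamma> t)) \<le> ?L ?us"
      proof -
        have "?L ts = (\<Sum>i<length ts - 1. ennreal (dist (\<gamma> (?us ! i)) (\<gamma> (?us ! Suc i))))"
          by (intro sum.cong refl) (auto simp: nth_append)
        also have "\<dots> \<le> (\<Sum>i<length ts. ennreal (dist (\<gamma> (?us ! i)) (\<gamma> (?us ! Suc i))))"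
          by (intro sum_mono2) auto
        finally have "?L ts \<le> (\<Sum>i<length ts. ennreal (dist (\<gamma> (?us ! i)) (\<gamma> (?us ! Suc i))))" .
        then show ?thesis by (simp add: nth_append add_right_mono)
      qed
      ultimately show "\<exists>us\<in>?S t. ?L ts + ennreal (dist (\<gamma> s) (\<gamma> t)) \<le> ?L us" by blast
    qed
    also have "\<dots> = ennreal t" using len[of t] st by (simp add: curve_length_def)
    finally show ?thesis using st by (simp flip: ennreal_plus)
  qed
  show ?thesis
  proof (rule lipschitz_onI)
    fix s t assume "s \<in> {0..l}" "t \<in> {0..l}"
    then show "dist (\<gamma> s) (\<gamma> t) \<le> 1 * dist s t"
      using step[of s t] step[of t s] by (cases "s \<le> t") (auto simp: dist_real_def dist_commute)
  qed simp
qed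

text \<open>Supplies the straight curve along which an upper gradient controls the difference of the
  values at two points. Polygon lengths telescope, and the polygon \<open>[0, t]\<close> attains the
  supremum.\<close>

lemma arc_length_curve_segment:
  fixes x y :: real
  assumes "x < y" "{x..y} \<subseteq> Y"
  shows "arc_length_curve Y (y - x) ((+) x)"
proof -
  have len: "curve_length ((+) x) 0 t = ennreal t" if "0 \<le> t" for t
  proof (rule antisym)
    show "curve_length ((+) x) 0 t \<le> ennreal t"
      unfolding curve_length_def
    proof (rule SUP_least, clarify)
      fix ts :: "real list" assume ts: "sorted ts" "set ts \<subseteq> {0..t}"
      have "(\<Sum>i<length ts - 1. ennreal (dist (x + ts ! i) (x + ts ! Suc i)))
          = (\<Sum>i<length ts - 1. ennreal (ts ! Suc i - ts ! i))"
        using ts(1) by (intro sum.cong refl arg_cong[where f = ennreal])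
          (auto simp: dist_real_def sorted_iff_nth_Suc)
      also have "\<dots> = ennreal (\<Sum>i<length ts - 1. ts ! Suc i - ts ! i)"
        using ts(1) by (intro sum_ennreal) (auto simp: sorted_iff_nth_Suc)
      also have "(\<Sum>i<length ts - 1. ts ! Suc i - ts ! i) = ts ! (length ts - 1) - ts ! 0"
        by (rule sum_lessThan_telescope)
      also have "\<dots> \<le> t"
      \<comment> \<open>For \<open>ts = []\<close> both indices are 0 by truncated subtraction, so
        the difference is 0 whatever \<open>ts ! 0\<close> may be.\<close>
      proof (cases "ts = []")
        case False
        then have "ts ! (length ts - 1) \<in> set ts" "ts ! 0 \<in> set ts" by auto
        then have "ts ! (length ts - 1) \<in> {0..t}" "ts ! 0 \<in> {0..t}" using ts(2) by blast+
        then show ?thesis by simp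
      qed (use that in simp)
      finally show "(\<Sum>i<length ts - 1. ennreal (dist (x + ts ! i) (x + ts ! Suc i))) \<le> ennreal t"
        by (simp add: ennreal_leI)
    qed
    show "ennreal t \<le> curve_length ((+) x) 0 t"
      unfolding curve_length_def using that
      by (intro SUP_upper2[of "[0, t]"]) (auto simp: dist_real_def)
  qed
  then show ?thesis
    using assms by (auto simp: arc_length_curve_def intro!: continuous_intros)
qed

section \<open>Primitives and their upper gradients\<close>

lemma nn_integral_atMost_split:
  fixes h :: "real \<Rightarrow> ennreal"
  assumes [measurable]: "h \<in> borel_measurable borel" and "x \<le> y"
  shows "(\<integral>\<^sup>+t\<in>{..y}. h t \<partial>lborel)
      = (\<integral>\<^sup>+t\<in>{..x}. h t \<partial>lborel) + (\<integral>\<^sup>+t\<in>{x<..y}. h t \<partial>lborel)"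
  using \<open>x \<le> y\<close> by (subst nn_integral_add[symmetric])
    (auto intro!: nn_integral_cong split: split_indicator)

text \<open>The increment of the primitive between the end points of a curve is the integral of
  \<open>h\<close> over the interval between them, which the curve has to traverse. Finiteness of
  the integral lets \<open>enn2real\<close> keep the values and turns the splitting of integrals
  into differences.\<close>

lemma upper_gradient_primitive:
  fixes h :: "real \<Rightarrow> ennreal"
  assumes h: "h \<in> borel_measurable borel" and fin: "integral\<^sup>N lborel h < \<infinity>"
  shows "upper_gradient Y (\<lambda>x. ereal (enn2real (\<integral>\<^sup>+t\<in>{..x}. h t \<partial>lborel))) h"
proof -
  define v where "v x = enn2real (\<integral>\<^sup>+t\<in>{..x}. h t \<partial>lborel)" for x
  have fin': "(\<integral>\<^sup>+t\<in>A. h t \<partial>lborel) < \<infinity>" for A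
    by (rule le_less_trans[OF _ fin]) (auto intro!: nn_integral_mono split: split_indicator)
  have diff: "ennreal \<bar>v x - v y\<bar> = (\<integral>\<^sup>+t\<in>{x<..y}. h t \<partial>lborel)" if "x \<le> y" for x y
  proof -
    have "v y = v x + enn2real (\<integral>\<^sup>+t\<in>{x<..y}. h t \<partial>lborel)"
      unfolding v_def nn_integral_atMost_split[OF h that]
      using fin' by (intro enn2real_plus) auto
    then show ?thesis using fin'[of "{x<..y}"] by simp
  qed
  have ext: "ext_diff (ereal a) (ereal b) = ennreal \<bar>a - b\<bar>" for a b
    by (simp add: ext_diff_def)
  have "ext_diff (ereal (v (\<gamma> 0))) (ereal (v (\<gamma> l))) \<le> (\<integral>\<^sup>+t\<in>{0..l}. h (\<gamma> t) \<partial>lborel)"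
    if \<gamma>: "arc_length_curve Y l \<gamma>" for l \<gamma>
  proof -
    have le: "(\<integral>\<^sup>+t\<in>I. h t \<partial>lborel) \<le> (\<integral>\<^sup>+t\<in>{0..l}. h (\<gamma> t) \<partial>lborel)"
      if "I \<in> sets borel" "I \<subseteq> closed_segment (\<gamma> 0) (\<gamma> l)" for I
      using that \<gamma> h
      by (intro nn_integral_le_along_lipschitz_curve arc_length_curve_lipschitz)
        (auto simp: arc_length_curve_def)
    show ?thesis
    proof (cases "\<gamma> 0 \<le> \<gamma> l")
      case True
      have "ext_diff (ereal (v (\<gamma> 0))) (ereal (v (\<gamma> l))) = (\<integral>\<^sup>+t\<in>{\<gamma> 0<..\<gamma> l}. h t \<partial>lborel)"
        using diff[OF True] by (simp add: ext)
      also have "\<dots> \<le> (\<integral>\<^sup>+t\<in>{0..l}. h (\<gamma> t) \<partial>lborel)"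
        using True by (intro le) (auto simp: closed_segment_eq_real_ivl)
      finally show ?thesis .
    next
      case False
      then have ge: "\<gamma> l \<le> \<gamma> 0" by simp
      have "ext_diff (ereal (v (\<gamma> 0))) (ereal (v (\<gamma> l))) = (\<integral>\<^sup>+t\<in>{\<gamma> l<..\<gamma> 0}. h t \<partial>lborel)"
        using diff[OF ge] by (simp add: ext abs_minus_commute)
      also have "\<dots> \<le> (\<integral>\<^sup>+t\<in>{0..l}. h (\<gamma> t) \<partial>lborel)"
        using ge by (intro le) (auto simp: closed_segment_eq_real_ivl)
      finally show ?thesis .
    qed
  qed
  then show ?thesis
    using h by (auto simp: upper_gradient_def v_def intro: measurable_restrict_space1)
qed

section \<open>Muckenhoupt's condition\<close>

lemma doubling_within_subset: "doubling_within M S \<Longrightarrow> T \<subseteq> S \<Longrightarrow> doubling_within M T"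
  unfolding doubling_within_def by (meson order_trans)

text \<open>The ball about \<open>x\<close> of radius \<open>3 * r\<close> lies within distance
  \<open>5 * r\<close> of \<open>z\<close>, hence in the ball of radius \<open>8 * r\<close> about
  \<open>z\<close>, which three doublings of \<open>ball z r\<close> reach. The last doubling starts
  from radius \<open>4 * r\<close>, and that ball lies in \<open>ball x (6 * r)\<close>; this is the
  origin of the factor 6.\<close>

lemma doubling_within_off_centre:
  assumes "doubling_within M S" and M: "measure_on_R M"
  obtains C where "0 < C"
    "\<And>x z r. 0 < r \<Longrightarrow> ball x (6 * r) \<subseteq> S \<Longrightarrow> \<bar>z - x\<bar> = 2 * r \<Longrightarrow>
      emeasure M (ball x (3 * r)) \<le> ennreal C * emeasure M (ball z r)"
proof -
  obtain C where C: "0 < C" "\<And>x r. 0 < r \<Longrightarrow> ball x r \<subseteq> S \<Longrightarrow>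
      emeasure M (ball x (2 * r)) \<le> ennreal C * emeasure M (ball x r)"
    using assms unfolding doubling_within_def by metis
  have "emeasure M (ball x (3 * r)) \<le> ennreal (C ^ 3) * emeasure M (ball z r)"
    if r: "0 < r" "ball x (6 * r) \<subseteq> S" "\<bar>z - x\<bar> = 2 * r" for x z r
  proof -
    have sub: "ball z s \<subseteq> S" if "s \<le> 4 * r" for s
      using that r by (intro order_trans[OF _ r(2)]) (auto simp: dist_real_def abs_if split: if_splits)
    have "ball x (3 * r) \<subseteq> ball z (2 * (2 * (2 * r)))"
      using r by (auto simp: dist_real_def abs_if split: if_splits)
    then have "emeasure M (ball x (3 * r)) \<le> emeasure M (ball z (2 * (2 * (2 * r))))"
      using M by (intro emeasure_mono) (auto simp: measure_on_R_def)
    also have "\<dots> \<le> ennreal C * emeasure M (ball z (2 * (2 * r)))"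
      using r by (intro C(2) sub) auto
    also have "\<dots> \<le> ennreal C * (ennreal C * emeasure M (ball z (2 * r)))"
      using r by (intro mult_left_mono C(2) sub) auto
    also have "\<dots> \<le> ennreal C * (ennreal C * (ennreal C * emeasure M (ball z r)))"
      using r by (intro mult_left_mono C(2) sub) auto
    also have "\<dots> = ennreal (C ^ 3) * emeasure M (ball z r)"
      using C(1) by (simp add: ennreal_mult power3_eq_cube ac_simps)
    finally show ?thesis .
  qed
  with C(1) show ?thesis by (intro that[of "C ^ 3"]) auto
qed

text \<open>Testing the Poincare inequality on the threefold ball with a primitive of \<open>f\<close>, which is
  constant on the two outer thirds; at least one of the two constants is far from the mean.\<close>

lemma admissible_within_imp_integral_le:
  assumes p: "1 \<le> p" and M: "measure_on_R M" and adm: "admissible_within p M S"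
  shows "\<exists>K>0. \<forall>x r f. 0 < r \<longrightarrow> ball x (6 * r) \<subseteq> S \<longrightarrow> f \<in> borel_measurable borel \<longrightarrow>
    integral\<^sup>N lborel f < \<infinity> \<longrightarrow> (\<forall>y. y \<notin> ball x r \<longrightarrow> f y = 0) \<longrightarrow>
    integral\<^sup>N lborel f \<le> ennreal (K * r) *
      ennpowr ((\<integral>\<^sup>+y\<in>ball x r. ennpowr (f y) p \<partial>M) / emeasure M (ball x r)) (1 / p)"
proof -
  obtain C where C: "0 < C"
    "\<And>x z r. 0 < r \<Longrightarrow> ball x (6 * r) \<subseteq> S \<Longrightarrow> \<bar>z - x\<bar> = 2 * r \<Longrightarrow>
      emeasure M (ball x (3 * r)) \<le> ennreal C * emeasure M (ball z r)"
    using doubling_within_off_centre adm M unfolding admissible_within_def by metis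
  obtain D \<Lambda> where D: "0 < D" "1 \<le> \<Lambda>"
    "\<And>x r u g. 0 < r \<Longrightarrow> ball x r \<subseteq> S \<Longrightarrow> integrable_on_set M (ball x (\<Lambda> * r)) u \<Longrightarrow>
      upper_gradient (ball x (\<Lambda> * r)) u g \<Longrightarrow>
      (\<integral>\<^sup>+y\<in>ball x r. e2ennreal \<bar>u y - ereal (mean M (ball x r) u)\<bar> \<partial>M) / emeasure M (ball x r)
      \<le> ennreal (D * r) *
        ennpowr ((\<integral>\<^sup>+y\<in>ball x (\<Lambda> * r). ennpowr (g y) p \<partial>M) / emeasure M (ball x (\<Lambda> * r))) (1 / p)"
    using adm unfolding admissible_within_def Poincare_within_def by blast
  have ball: "ball x r \<in> sets M" "emeasure M (ball x r) < \<infinity>" for x r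
    using M by (cases "0 < r"; auto simp: measure_on_R_def not_less ball_empty)+
  have ball_pos: "0 < r \<Longrightarrow> 0 < emeasure M (ball x r)" for x r
    using M by (simp add: measure_on_R_def)
  \<comment> \<open>The factor 6 is 2 times 3: 2 because the deviation found below is half of the
    total integral, 3 from the radius of the threefold ball.\<close>
  have "integral\<^sup>N lborel f \<le> ennreal (6 * C * D * r) *
      ennpowr ((\<integral>\<^sup>+y\<in>ball x r. ennpowr (f y) p \<partial>M) / emeasure M (ball x r)) (1 / p)"
    if r: "0 < r" "ball x (6 * r) \<subseteq> S" and f: "f \<in> borel_measurable borel"
      and fin: "integral\<^sup>N lborel f < \<infinity>" and supp: "\<And>y. y \<notin> ball x r \<Longrightarrow> f y = 0" for x r f
  proof -
    let ?B = "ball x (3 * r)" and ?A = "ball x (\<Lambda> * (3 * r))"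
    obtain j where j: "integral\<^sup>N lborel f = ennreal j" "0 \<le> j"
      using fin by (cases "integral\<^sup>N lborel f") auto
    define v where "v y = enn2real (\<integral>\<^sup>+t\<in>{..y}. f t \<partial>lborel)" for y
    have le: "(\<integral>\<^sup>+t\<in>{..y}. f t \<partial>lborel) \<le> ennreal j" for y
      unfolding j(1)[symmetric] by (intro nn_integral_mono) (auto split: split_indicator)
    have v: "0 \<le> v y" "v y \<le> j" for y
      using le[of y] j(2) by (auto simp: v_def enn2real_leI)
    have "mono v"
      unfolding v_def using le
      by (auto intro!: monoI enn2real_mono nn_integral_mono le_less_trans[OF le]
        split: split_indicator)
    then have v_meas: "v \<in> borel_measurable borel"
      by (rule borel_measurable_mono)
    have v_left: "v y = 0" if "y \<in> ball (x - 2 * r) r" for y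
    proof -
      have "(\<integral>\<^sup>+t\<in>{..y}. f t \<partial>lborel) = (\<integral>\<^sup>+t. 0 \<partial>(lborel :: real measure))"
        using that by (intro nn_integral_cong) (auto simp: dist_real_def supp split: split_indicator)
      then show ?thesis by (simp add: v_def)
    qed
    have v_right: "v y = j" if "y \<in> ball (x + 2 * r) r" for y
    proof -
      have "(\<integral>\<^sup>+t\<in>{..y}. f t \<partial>lborel) = integral\<^sup>N lborel f"
        using that by (intro nn_integral_cong) (auto simp: dist_real_def intro!: supp split: split_indicator)
      then show ?thesis using j by (simp add: v_def)
    qed
    define u where "u y = ereal (v y)" for y
    have "v \<in> borel_measurable M"
      using v_meas M by (auto simp: measure_on_R_def measurable_def)
    then have "v \<in> borel_measurable (restrict_space M ?A)"
      by (rule measurable_restrict_space1)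
    then have "u \<in> borel_measurable (restrict_space M ?A)"
      unfolding u_def by measurable
    moreover have "(\<integral>\<^sup>+y\<in>?A. e2ennreal \<bar>u y\<bar> \<partial>M) < \<infinity>"
    proof -
      have "(\<integral>\<^sup>+y\<in>?A. e2ennreal \<bar>u y\<bar> \<partial>M) \<le> (\<integral>\<^sup>+y. ennreal j * indicator ?A y \<partial>M)"
        using v by (intro nn_integral_mono) (auto simp: u_def intro!: ennreal_leI split: split_indicator)
      also have "\<dots> < \<infinity>"
        unfolding nn_integral_cmult_indicator[OF ball(1)]
        using ball(2) by (simp add: ennreal_mult_less_top)
      finally show ?thesis .
    qed
    ultimately have u_int: "integrable_on_set M ?A u"
      by (simp add: integrable_on_set_def)
    have u_grad: "upper_gradient ?A u f"
      unfolding u_def v_def by (rule upper_gradient_primitive[OF f fin])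
    define m where "m = mean M ?B u"
    \<comment> \<open>The values 0 and \<open>j\<close> are \<open>j\<close> apart, so one of them
      is at least \<open>j / 2\<close> away from \<open>m\<close>; \<open>z\<close> is the centre of
      the outer third on which \<open>v\<close> takes that value.\<close>
    have "j / 2 \<le> \<bar>0 - m\<bar> \<or> j / 2 \<le> \<bar>j - m\<bar>" by arith
    then obtain z where z: "\<bar>z - x\<bar> = 2 * r" "\<And>y. y \<in> ball z r \<Longrightarrow> j / 2 \<le> \<bar>v y - m\<bar>"
    proof (elim disjE)
      assume "j / 2 \<le> \<bar>0 - m\<bar>"
      then show ?thesis using r v_left by (intro that[of "x - 2 * r"]) auto
    next
      assume "j / 2 \<le> \<bar>j - m\<bar>"
      then show ?thesis using r v_right by (intro that[of "x + 2 * r"]) auto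
    qed
    define Q where "Q = (\<integral>\<^sup>+y\<in>?B. e2ennreal \<bar>u y - ereal m\<bar> \<partial>M)"
    have zB: "ball z r \<subseteq> ?B"
      using z(1) by (auto simp: dist_real_def abs_if split: if_splits)
    have "ennreal (j / 2) * emeasure M (ball z r) = (\<integral>\<^sup>+y. ennreal (j / 2) * indicator (ball z r) y \<partial>M)"
      by (rule nn_integral_cmult_indicator[OF ball(1), symmetric])
    also have "\<dots> \<le> Q"
      unfolding Q_def
    proof (rule nn_integral_mono)
      fix y
      show "ennreal (j / 2) * indicator (ball z r) y \<le> e2ennreal \<bar>u y - ereal m\<bar> * indicator ?B y"
      proof (cases "y \<in> ball z r")
        case True
        then have "y \<in> ?B" using zB by blast
        with z(2)[OF True] True show ?thesis by (simp add: u_def ennreal_leI)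
      qed simp
    qed
    finally have Q: "ennreal (j / 2) * emeasure M (ball z r) \<le> Q" .
    \<comment> \<open>By doubling, that third carries at least the fraction 1/\<open>C\<close> of
      the mass of the threefold ball, so the deviation on it bounds the mean oscillation over the
      whole ball from below.\<close>
    have "emeasure M ?B * ennreal (j / 2) \<le> ennreal C * emeasure M (ball z r) * ennreal (j / 2)"
      using C(2)[OF r z(1)] by (rule mult_right_mono) simp
    also have "\<dots> \<le> ennreal C * Q"
      using mult_left_mono[OF Q, of "ennreal C"] by (simp add: ac_simps)
    also have "\<dots> = emeasure M ?B * (ennreal C * (Q / emeasure M ?B))"
      using ball[of x "3 * r"] ball_pos[of "3 * r" x] r
      by (intro ennreal_mult_divide_cancel[symmetric]) auto
    finally have *: "emeasure M ?B * ennreal (j / 2) \<le> emeasure M ?B * (ennreal C * (Q / emeasure M ?B))" .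
    have "ennreal (j / 2) \<le> ennreal C * (Q / emeasure M ?B)"
      using ball ball_pos r by (intro ennreal_mult_le_imp_le[OF _ _ *]) auto
    moreover have "Q / emeasure M ?B \<le> ennreal (D * (3 * r)) *
        ennpowr ((\<integral>\<^sup>+y\<in>?A. ennpowr (f y) p \<partial>M) / emeasure M ?A) (1 / p)"
      unfolding Q_def m_def
    proof (rule D(3)[OF _ _ u_int u_grad])
      show "?B \<subseteq> S" using r by (intro order_trans[OF subset_ball r(2)]) auto
    qed (use r in simp)
    \<comment> \<open>\<open>f\<close> vanishes outside \<open>ball x r\<close>, so shrinking the
      domain from \<open>?A\<close> keeps the integral, while the measure in the denominator does
      not grow because \<Lambda> \<ge> 1.\<close>
    moreover have "(\<integral>\<^sup>+y\<in>?A. ennpowr (f y) p \<partial>M) / emeasure M ?A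
        \<le> (\<integral>\<^sup>+y\<in>ball x r. ennpowr (f y) p \<partial>M) / emeasure M (ball x r)"
    proof (rule order_trans[OF divide_right_mono_ennreal divide_left_mono_ennreal])
      show "(\<integral>\<^sup>+y\<in>?A. ennpowr (f y) p \<partial>M) \<le> (\<integral>\<^sup>+y\<in>ball x r. ennpowr (f y) p \<partial>M)"
      proof (rule nn_integral_mono)
        fix y
        show "ennpowr (f y) p * indicator ?A y \<le> ennpowr (f y) p * indicator (ball x r) y"
          using supp[of y] by (cases "y \<in> ball x r") (auto simp: ennpowr_def split: split_indicator)
      qed
      have "1 * r \<le> \<Lambda> * (3 * r)"
        using D(2) r by (intro mult_mono) auto
      then show "emeasure M (ball x r) \<le> emeasure M ?A"
        using ball by (intro emeasure_mono subset_ball) auto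
    qed (use ball_pos r in simp)
    ultimately have "ennreal (j / 2) \<le> ennreal C * (ennreal (D * (3 * r)) *
        ennpowr ((\<integral>\<^sup>+y\<in>ball x r. ennpowr (f y) p \<partial>M) / emeasure M (ball x r)) (1 / p))"
      (is "_ \<le> _ * (_ * ?E)")
      using p by (elim order_trans[OF _ mult_left_mono] order_trans) (auto intro!: mult_left_mono ennpowr_mono)
    then have "ennreal 2 * ennreal (j / 2) \<le> ennreal 2 * (ennreal C * (ennreal (D * (3 * r)) * ?E))"
      by (rule mult_left_mono) simp
    also have "\<dots> = ennreal (2 * (C * (D * (3 * r)))) * ?E"
    proof -
      have "ennreal (2 * (C * d)) = ennreal 2 * (ennreal C * ennreal d)" if "0 \<le> d" for d
        using C(1) that by (simp add: ennreal_mult)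
      from this[of "D * (3 * r)"] show ?thesis
        using D(1) r(1) by (simp add: mult.assoc)
    qed
    also have "2 * (C * (D * (3 * r))) = 6 * C * D * r"
      by simp
    also have "ennreal 2 * ennreal (j / 2) = integral\<^sup>N lborel f"
      using j ennreal_mult[of 2 "j / 2"] by simp
    finally show ?thesis .
  qed
  then show ?thesis
    using C(1) D(1) by (intro exI[of _ "6 * C * D"] conjI allI impI) auto
qed

text \<open>For \<open>p > 1\<close> the best \<open>h\<close> is a power of the density of \<open>M\<close>, which turns this into the
  usual \<open>A\<^sub>p\<close> condition; in this form no absolute continuity of \<open>M\<close> is needed, and the condition
  is visibly additive in \<open>M\<close>.\<close>

definition Muckenhoupt_within :: "real \<Rightarrow> real measure \<Rightarrow> real set \<Rightarrow> bool" where
  "Muckenhoupt_within p M S \<longleftrightarrow>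
     (\<exists>K>0. \<forall>x r. 0 < r \<longrightarrow> ball x r \<subseteq> S \<longrightarrow> (\<forall>h\<in>borel_measurable borel.
        (\<integral>\<^sup>+y\<in>ball x r. h y \<partial>lborel) \<le> ennreal (K * r) *
          ennpowr ((\<integral>\<^sup>+y\<in>ball x r. ennpowr (h y) p \<partial>M) / emeasure M (ball x r)) (1 / p)))"

text \<open>The preceding bound concerns integrable functions supported in the ball. It is applied
  to the truncations of \<open>h\<close> at height \<open>n\<close>, set to zero off the ball, and
  monotone convergence recovers \<open>h\<close>, even if its integral is infinite.\<close>

lemma admissible_within_imp_Muckenhoupt_within:
  assumes p: "1 \<le> p" and M: "measure_on_R M" and adm: "admissible_within p M S"
    and T: "\<And>x r. 0 < r \<Longrightarrow> ball x r \<subseteq> T \<Longrightarrow> ball x (6 * r) \<subseteq> S"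
  shows "Muckenhoupt_within p M T"
proof -
  obtain K where K: "0 < K"
    "\<And>x r f. 0 < r \<Longrightarrow> ball x (6 * r) \<subseteq> S \<Longrightarrow> f \<in> borel_measurable borel \<Longrightarrow>
      integral\<^sup>N lborel f < \<infinity> \<Longrightarrow> (\<forall>y. y \<notin> ball x r \<longrightarrow> f y = 0) \<Longrightarrow>
      integral\<^sup>N lborel f \<le> ennreal (K * r) *
        ennpowr ((\<integral>\<^sup>+y\<in>ball x r. ennpowr (f y) p \<partial>M) / emeasure M (ball x r)) (1 / p)"
    using admissible_within_imp_integral_le[OF p M adm] by blast
  have "(\<integral>\<^sup>+y\<in>ball x r. h y \<partial>lborel) \<le> ennreal (K * r) *
      ennpowr ((\<integral>\<^sup>+y\<in>ball x r. ennpowr (h y) p \<partial>M) / emeasure M (ball x r)) (1 / p)"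
    if r: "0 < r" "ball x (6 * r) \<subseteq> S" and h[measurable]: "h \<in> borel_measurable borel" for x r h
  proof -
    have [measurable]: "ball x r \<in> sets borel" by simp
    let ?f = "\<lambda>n y. min (h y) (of_nat n) * indicator (ball x r) y"
    have "h y * indicator (ball x r) y = (SUP n. ?f n y)" for y
    proof (cases "y \<in> ball x r")
      case True
      have "(SUP n. min (h y) (of_nat n)) = h y"
        by (simp add: inf_min[symmetric] inf_SUP[symmetric] ennreal_SUP_of_nat_eq_top)
      with True show ?thesis by simp
    qed simp
    then have "(\<integral>\<^sup>+y\<in>ball x r. h y \<partial>lborel) = (\<integral>\<^sup>+y. (SUP n. ?f n y) \<partial>lborel)"
      by simp
    also have "\<dots> = (SUP n. integral\<^sup>N lborel (?f n))"
      by (intro nn_integral_monotone_convergence_SUP)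
        (auto simp: incseq_def le_fun_def split: split_indicator intro!: min.coboundedI2 of_nat_mono)
    also have "\<dots> \<le> ennreal (K * r) *
        ennpowr ((\<integral>\<^sup>+y\<in>ball x r. ennpowr (h y) p \<partial>M) / emeasure M (ball x r)) (1 / p)"
    proof (rule SUP_least)
      fix n
      have "integral\<^sup>N lborel (?f n) \<le> (\<integral>\<^sup>+y. of_nat n * indicator (ball x r) y \<partial>lborel)"
        by (intro nn_integral_mono) (auto split: split_indicator)
      also have "\<dots> < \<infinity>"
        using r by (simp add: nn_integral_cmult ball_eq_greaterThanLessThan ennreal_mult_less_top of_nat_less_top)
      finally have "integral\<^sup>N lborel (?f n) \<le> ennreal (K * r) *
          ennpowr ((\<integral>\<^sup>+y\<in>ball x r. ennpowr (?f n y) p \<partial>M) / emeasure M (ball x r)) (1 / p)"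
        using r by (intro K(2)) auto
      also have "\<dots> \<le> ennreal (K * r) *
          ennpowr ((\<integral>\<^sup>+y\<in>ball x r. ennpowr (h y) p \<partial>M) / emeasure M (ball x r)) (1 / p)"
        using p by (intro mult_left_mono ennpowr_mono divide_right_mono_ennreal nn_integral_mono)
          (auto intro!: ennpowr_mono split: split_indicator)
      finally show "integral\<^sup>N lborel (?f n) \<le> ennreal (K * r) *
          ennpowr ((\<integral>\<^sup>+y\<in>ball x r. ennpowr (h y) p \<partial>M) / emeasure M (ball x r)) (1 / p)" .
    qed
    finally show ?thesis .
  qed
  with K(1) T show ?thesis
    unfolding Muckenhoupt_within_def by (intro exI[of _ K] conjI allI impI ballI) auto
qed

text \<open>The Lebesgue integral on the left is the same for both measures. With the larger of the
  two constants the inequalities have equal factors, so they add in their linear form.\<close>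

lemma Muckenhoupt_within_sum_measure:
  assumes p: "1 \<le> p" and M: "measure_on_R M" and N: "measure_on_R N"
    and "Muckenhoupt_within p M S" "Muckenhoupt_within p N S"
  shows "Muckenhoupt_within p (sum_measure M N) S"
proof -
  have sp: "space M = space N" using M N by (simp add: measure_on_R_def)
  obtain K where K: "0 < K" "\<And>x r h. 0 < r \<Longrightarrow> ball x r \<subseteq> S \<Longrightarrow> h \<in> borel_measurable borel \<Longrightarrow>
      (\<integral>\<^sup>+y\<in>ball x r. h y \<partial>lborel) \<le> ennreal (K * r) *
        ennpowr ((\<integral>\<^sup>+y\<in>ball x r. ennpowr (h y) p \<partial>M) / emeasure M (ball x r)) (1 / p)"
    using assms(4) unfolding Muckenhoupt_within_def by blast
  obtain L where L: "\<And>x r h. 0 < r \<Longrightarrow> ball x r \<subseteq> S \<Longrightarrow> h \<in> borel_measurable borel \<Longrightarrow>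
      (\<integral>\<^sup>+y\<in>ball x r. h y \<partial>lborel) \<le> ennreal (L * r) *
        ennpowr ((\<integral>\<^sup>+y\<in>ball x r. ennpowr (h y) p \<partial>N) / emeasure N (ball x r)) (1 / p)"
    using assms(5) unfolding Muckenhoupt_within_def by blast
  show ?thesis
    unfolding Muckenhoupt_within_def
  proof (intro exI[of _ "max K L"] conjI allI impI ballI)
    fix x r :: real and h :: "real \<Rightarrow> ennreal"
    assume r: "0 < r" "ball x r \<subseteq> S" and h [measurable]: "h \<in> borel_measurable borel"
    let ?B = "ball x r"
    have sets: "?B \<in> sets M" "?B \<in> sets N" and pos: "0 < emeasure M ?B" "0 < emeasure N ?B"
      and fin: "emeasure M ?B < \<infinity>" "emeasure N ?B < \<infinity>"
      using M N r by (auto simp: measure_on_R_def)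
    have [measurable]: "?B \<in> sets borel" by simp
    have "(\<lambda>y. ennpowr (h y) p * indicator ?B y) \<in> borel_measurable borel" by measurable
    then have meas: "(\<lambda>y. ennpowr (h y) p * indicator ?B y) \<in> borel_measurable (sum_measure M N)"
      using measure_on_R_sum_measure[OF M N] by (auto simp: measure_on_R_def measurable_def)
    have "(\<integral>\<^sup>+y\<in>?B. h y \<partial>lborel) \<le> ennreal (max K L * r) * ennpowr
        (((\<integral>\<^sup>+y\<in>?B. ennpowr (h y) p \<partial>M) + (\<integral>\<^sup>+y\<in>?B. ennpowr (h y) p \<partial>N))
          / (emeasure M ?B + emeasure N ?B)) (1 / p)"
    proof (rule le_ennpowr_mean_add)
      show "(\<integral>\<^sup>+y\<in>?B. h y \<partial>lborel) \<le> ennreal (max K L * r) *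
          ennpowr ((\<integral>\<^sup>+y\<in>?B. ennpowr (h y) p \<partial>M) / emeasure M ?B) (1 / p)"
        using r by (intro order_trans[OF K(2)[OF r h]] mult_right_mono ennreal_leI) auto
      show "(\<integral>\<^sup>+y\<in>?B. h y \<partial>lborel) \<le> ennreal (max K L * r) *
          ennpowr ((\<integral>\<^sup>+y\<in>?B. ennpowr (h y) p \<partial>N) / emeasure N ?B) (1 / p)"
        using r by (intro order_trans[OF L[OF r h]] mult_right_mono ennreal_leI) auto
    qed (use p pos fin in auto)
    then show "(\<integral>\<^sup>+y\<in>?B. h y \<partial>lborel) \<le> ennreal (max K L * r) * ennpowr
        ((\<integral>\<^sup>+y\<in>?B. ennpowr (h y) p \<partial>sum_measure M N) / emeasure (sum_measure M N) ?B) (1 / p)"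
      unfolding nn_integral_sum_measure[OF sp meas] emeasure_sum_measure[OF sp sets] .
  qed (use K(1) in auto)
qed

section \<open>From Muckenhoupt's condition back to the Poincare inequality\<close>

text \<open>Two points of the ball are joined by a segment inside it, so the values of
  \<open>u\<close> differ by at most the integral of \<open>g\<close> over the ball. Each value then
  differs from the mean by at most as much, and averaging keeps the bound.\<close>

lemma Poincare_oscillation:
  assumes M: "measure_on_R M" and r: "0 < r"
    and u: "integrable_on_set M (ball x r) u" and g: "upper_gradient (ball x r) u g"
  shows "(\<integral>\<^sup>+y\<in>ball x r. e2ennreal \<bar>u y - ereal (mean M (ball x r) u)\<bar> \<partial>M) / emeasure M (ball x r)
    \<le> (\<integral>\<^sup>+y\<in>ball x r. g y \<partial>lborel)"
proof (cases "(\<integral>\<^sup>+y\<in>ball x r. g y \<partial>lborel)")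
  \<comment> \<open>If the integral of \<open>g\<close> is infinite there is nothing to prove;
    \<open>j\<close> is its finite value.\<close>
  case (real j)
  let ?B = "ball x r"
  have h: "(\<lambda>y. g y * indicator ?B y) \<in> borel_measurable borel"
    using g by (simp add: upper_gradient_def borel_measurable_restrict_space_iff_ennreal)
  have osc: "ext_diff (u y) (u z) \<le> ennreal j" if "y \<in> ?B" "z \<in> ?B" "y < z" for y z
  proof -
    have seg: "{y..z} \<subseteq> ?B"
      using that by (auto simp: dist_real_def)
    have "ext_diff (u (y + 0)) (u (y + (z - y))) \<le> (\<integral>\<^sup>+t\<in>{0..z - y}. g (y + t) \<partial>lborel)"
      using g arc_length_curve_segment[OF \<open>y < z\<close> seg] unfolding upper_gradient_def by blast
    also have "\<dots> \<le> (\<integral>\<^sup>+t. g (y + t) * indicator ?B (y + t) \<partial>lborel)"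
      using seg by (intro nn_integral_mono) (auto split: split_indicator simp: subset_eq)
    also have "\<dots> = (\<integral>\<^sup>+y\<in>?B. g y \<partial>lborel)"
      using nn_integral_real_affine[OF h, of 1 y] by simp
    finally show ?thesis using real by simp
  qed
  have ext_commute: "ext_diff a b = ext_diff b a" for a b
    by (cases a; cases b) (auto simp: ext_diff_def abs_minus_commute)
  have osc': "ext_diff (u y) (u z) \<le> ennreal j" if "y \<in> ?B" "z \<in> ?B" "y \<noteq> z" for y z
    using osc[of y z] osc[of z y] that ext_commute by (cases "y < z") auto
  define v where "v y = real_of_ereal (u y)" for y
  \<comment> \<open>\<open>ext_diff\<close> is infinite as soon as one value is, so the finite bound
    against a second point \<open>z\<close> forces \<open>u y\<close> to be finite, at every point
    of the ball and not merely almost everywhere.\<close>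
  have uv: "u y = ereal (v y)" if "y \<in> ?B" for y
  proof -
    obtain z where "z \<in> ?B" "y \<noteq> z"
      using r by (metis centre_in_ball mem_ball dist_real_def abs_of_pos add_diff_cancel_left'
        dist_commute field_sum_of_halves less_add_same_cancel1 half_gt_zero less_irrefl)
    then have "\<bar>u y\<bar> \<noteq> \<infinity>"
      using osc'[OF that, of z] by (auto simp: ext_diff_def top_unique split: if_splits)
    then show ?thesis by (simp add: v_def ereal_real)
  qed
  have vv: "\<bar>v y - v z\<bar> \<le> j" if "y \<in> ?B" "z \<in> ?B" for y z
    using osc'[OF that] uv that real by (cases "y = z") (auto simp: ext_diff_def)
  \<comment> \<open>On the ball as a space of finite measure the bounded \<open>v\<close> is
    integrable and can be compared with constants.\<close>
  let ?N = "restrict_space M ?B"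
  have B: "?B \<in> sets M" "?B \<inter> space M = ?B" "emeasure M ?B < \<infinity>" "0 < emeasure M ?B"
    using M r by (auto simp: measure_on_R_def)
  interpret N: finite_measure ?N
    using B by (intro finite_measureI) (auto simp: space_restrict_space emeasure_restrict_space)
  have spN: "space ?N = ?B" "measure ?N ?B = measure M ?B"
    using B by (simp_all add: space_restrict_space measure_restrict_space)
  have mpos: "0 < measure M ?B"
    using B by (simp add: measure_def enn2real_positive_iff)
  have "v \<in> borel_measurable ?N"
    using u unfolding integrable_on_set_def v_def by (auto intro: borel_measurable_real_of_ereal)
  then have int: "integrable ?N v"
    using vv[of x] r by (intro N.integrable_const_bound[of _ "\<bar>v x\<bar> + j"]) (force simp: spN)+
  have mean: "integral\<^sup>L ?N v = mean M ?B u * measure M ?B"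
    using B mpos by (simp add: mean_def v_def set_lebesgue_integral_def integral_restrict_space)
  have dev: "\<bar>v y - mean M ?B u\<bar> \<le> j" if y: "y \<in> ?B" for y
  proof -
    have "integral\<^sup>L ?N v \<le> integral\<^sup>L ?N (\<lambda>_. v y + j)"
      using int vv[OF y] by (intro integral_mono) (force simp: spN)+
    then have 1: "mean M ?B u * measure M ?B \<le> (v y + j) * measure M ?B"
      by (simp add: mean spN mult.commute)
    have "integral\<^sup>L ?N (\<lambda>_. v y - j) \<le> integral\<^sup>L ?N v"
      using int vv[OF y] by (intro integral_mono) (force simp: spN)+
    then have 2: "(v y - j) * measure M ?B \<le> mean M ?B u * measure M ?B"
      by (simp add: mean spN mult.commute)
    show ?thesis using 1 2 mpos by (simp add: abs_le_iff)
  qed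
  have "(\<integral>\<^sup>+y\<in>?B. e2ennreal \<bar>u y - ereal (mean M ?B u)\<bar> \<partial>M) \<le> (\<integral>\<^sup>+y. ennreal j * indicator ?B y \<partial>M)"
    using dev real by (intro nn_integral_mono) (auto simp: uv split: split_indicator intro!: ennreal_leI)
  also have "\<dots> = ennreal j * emeasure M ?B"
    by (intro nn_integral_cmult_indicator B)
  finally show ?thesis
    using B real by (simp add: divide_le_posI_ennreal mult.commute)
qed simp

text \<open>The oscillation of \<open>u\<close> is bounded by the Lebesgue integral of
  \<open>g\<close> over the ball, which is what Muckenhoupt's condition estimates; both concern the
  same ball, so the dilation is 1.\<close>

lemma Muckenhoupt_within_imp_Poincare_within:
  assumes M: "measure_on_R M" and "Muckenhoupt_within p M S"
  shows "Poincare_within p M S"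
proof -
  obtain K where K: "0 < K" "\<And>x r h. 0 < r \<Longrightarrow> ball x r \<subseteq> S \<Longrightarrow> h \<in> borel_measurable borel \<Longrightarrow>
      (\<integral>\<^sup>+y\<in>ball x r. h y \<partial>lborel) \<le> ennreal (K * r) *
        ennpowr ((\<integral>\<^sup>+y\<in>ball x r. ennpowr (h y) p \<partial>M) / emeasure M (ball x r)) (1 / p)"
    using assms(2) unfolding Muckenhoupt_within_def by blast
  have "(\<integral>\<^sup>+y\<in>ball x r. e2ennreal \<bar>u y - ereal (mean M (ball x r) u)\<bar> \<partial>M) / emeasure M (ball x r)
      \<le> ennreal (K * r) *
        ennpowr ((\<integral>\<^sup>+y\<in>ball x r. ennpowr (g y) p \<partial>M) / emeasure M (ball x r)) (1 / p)"
    if r: "0 < r" "ball x r \<subseteq> S" and u: "integrable_on_set M (ball x r) u"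
      and g: "upper_gradient (ball x r) u g" for x r u g
  proof -
    let ?B = "ball x r"
    \<comment> \<open>Extension by zero, since \<open>g\<close> is Borel only on the ball while
      Muckenhoupt's condition speaks of functions that are Borel on the line.\<close>
    define h where "h y = g y * indicator ?B y" for y
    have h: "h \<in> borel_measurable borel"
      using g unfolding h_def by (simp add: upper_gradient_def borel_measurable_restrict_space_iff_ennreal)
    have gh: "(\<integral>\<^sup>+y\<in>?B. F (g y) \<partial>N) = (\<integral>\<^sup>+y\<in>?B. F (h y) \<partial>N)" for F and N :: "real measure"
      by (intro nn_integral_cong) (auto simp: h_def split: split_indicator)
    show ?thesis
      using order_trans[OF Poincare_oscillation[OF M r(1) u g]] K(2)[OF r h]
      unfolding gh[where F = "\<lambda>y. y"] gh[where F = "\<lambda>y. ennpowr y p"] by blast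
  qed
  then show ?thesis
    unfolding Poincare_within_def using K(1)
    by (intro exI[of _ K] exI[of _ 1] conjI allI impI) (simp_all only: mult_1 order_refl)
qed

section \<open>Local admissibility of the sum\<close>

theorem corollary5p1:
  fixes p :: real and M1 M2 :: "real measure"
  assumes "1 \<le> p"
    and "measure_on_R M1" and "locally_admissible p M1"
    and "measure_on_R M2" and "locally_admissible p M2"
  shows "measure_on_R (sum_measure M1 M2) \<and> locally_admissible p (sum_measure M1 M2)"
proof
  show "measure_on_R (sum_measure M1 M2)"
    using assms by (intro measure_on_R_sum_measure)
  show "locally_admissible p (sum_measure M1 M2)"
    unfolding locally_admissible_def
  proof
    fix x0
    obtain R1 where R1: "0 < R1" "admissible_within p M1 (ball x0 R1)"
      using assms(3) unfolding locally_admissible_def by blast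
    obtain R2 where R2: "0 < R2" "admissible_within p M2 (ball x0 R2)"
      using assms(5) unfolding locally_admissible_def by blast
    \<comment> \<open>Balls inside \<open>ball x0 R\<close> must keep their sixfold enlargements
      inside both given balls: \<open>dist x x0 + r \<le> R\<close> implies
      \<open>dist x x0 + 6 * r \<le> 6 * R\<close>, hence the divisor 6.\<close>
    define R where "R = min R1 R2 / 6"
    have R: "0 < R" "6 * R \<le> R1" "6 * R \<le> R2"
      using R1 R2 by (auto simp: R_def)
    have sub: "ball x (6 * r) \<subseteq> ball x0 (6 * R)" if "0 < r" "ball x r \<subseteq> ball x0 R" for x r
    proof -
      have "dist x x0 + r \<le> R"
        using that by (simp add: ball_subset_ball_iff)
      then show ?thesis
        using zero_le_dist[of x x0] unfolding ball_subset_ball_iff by linarith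
    qed
    have "Muckenhoupt_within p M1 (ball x0 R)"
      using R by (intro admissible_within_imp_Muckenhoupt_within[OF assms(1,2) R1(2)]
        order_trans[OF sub subset_ball]) auto
    moreover have "Muckenhoupt_within p M2 (ball x0 R)"
      using R by (intro admissible_within_imp_Muckenhoupt_within[OF assms(1,4) R2(2)]
        order_trans[OF sub subset_ball]) auto
    ultimately have "Poincare_within p (sum_measure M1 M2) (ball x0 R)"
      using assms by (intro Muckenhoupt_within_imp_Poincare_within Muckenhoupt_within_sum_measure
        measure_on_R_sum_measure)
    moreover have "doubling_within (sum_measure M1 M2) (ball x0 R)"
      using R R1 R2 assms unfolding admissible_within_def
      by (intro doubling_within_sum_measure)
        (auto elim!: doubling_within_subset intro!: subset_ball)
    ultimately show "\<exists>R>0. admissible_within p (sum_measure M1 M2) (ball x0 R)"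
      using R by (auto simp: admissible_within_def)
  qed
qed

end
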